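(* Let $\Omega\subseteq\mathbb{R}^n$ be a bounded domain, $r>0$, and let $E$ be a minimizer for $\mathrm{Per}_r$ in $\Omega$. Let $R_o>0$. Suppose that $B_{R_o}\subseteq\Omega$ and $$\omega_o:=\mathcal{L}^n(E\cap B_{R_o})>0.$$ Let also $k\in\mathbb{N}$ be such that $B_{R_o+2kr}\subseteq\Omega$. Then $$\mathcal{L}^n(E\cap B_{R_o+2kr})\ge\big(\omega_o^{\frac1n}+2c_\star kr\big)^n,$$ for a suitable $c_\star>0$, possibly depending on $n$, $r$ and $\omega_o$. Moreover, if $n=1$, $c_\star$ is a pure number, independent of $r$ and $\omega_o$. Also, if $\omega_o\ge\underline{c}\,r^n$ for some $\underline{c}>0$, then $c_\star$ only depends on $n$ and $\underline{c}$, and it is independent of $\Omega$ and $\omega_o$. In addition, if (with $k\ge1$) $$\mathcal{L}^n(E\cap B_{R_o+2(k-1)r})\le\overline{C}\,r^n$$ for some $\overline{C}>0$, then $$\mathcal{L}^n(E\cap B_{R_o+2kr})\ge\omega_o\,(1+\widetilde c)^k,$$ for some $\widetilde c>0$, depending on $n$ and $\overline{C}$.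
   Context: $B_\rho(x)$ is the ball of radius $\rho$ centered at $x$ in $\mathbb{R}^n$, $B_\rho:=B_\rho(0)$, and $\mathcal{L}^n$ is the $n$-dimensional Lebesgue measure. For $A\subseteq\mathbb{R}^n$, $A\oplus B_r:=\bigcup_{x\in A}B_r(x)$ and $A\ominus B_r:=A\setminus\big((\partial A)\oplus B_r\big)$. Measurable sets are identified with their sets of points of density one (so equalities of sets are up to null sets), and $\partial E$ denotes the topological boundary of the set of points of density one of $E$. For a domain $\Omega$ and measurable $E\subseteq\mathbb{R}^n$, $$\mathrm{Per}_r(E,\Omega):=\frac{1}{2r}\mathcal{L}^n\Big(\big((\partial E)\oplus B_r\big)\cap\Omega\Big).$$ A set $E$ is a minimizer for $\mathrm{Per}_r$ in a bounded domain $\Omega$ if $\mathrm{Per}_r(E,\Omega)\le\mathrm{Per}_r(F,\Omega)$ for any measurable $F\subseteq\mathbb{R}^n$ with $F\setminus(\Omega\ominus B_r)=E\setminus(\Omega\ominus B_r)$. *)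

theory Defs
  imports "HOL-Analysis.Analysis"
begin

definition ball_dilation :: "'a::metric_space set \<Rightarrow> real \<Rightarrow> 'a set" where
  "ball_dilation A r = (\<Union>x\<in>A. ball x r)"

text \<open>The boundary in the erosion is the plain topological one. The erosion is applied below to the
  domain \<open>\<Omega>\<close>, which is an actual open set and not a class of measurable sets modulo null sets.\<close>

definition ball_erosion :: "'a::metric_space set \<Rightarrow> real \<Rightarrow> 'a set" where
  "ball_erosion A r = A - ball_dilation (frontier A) r"

definition density_one :: "'a::euclidean_space set \<Rightarrow> 'a set" where
  "density_one E =
     {x. ((\<lambda>\<rho>. measure lebesgue (E \<inter> ball x \<rho>) / measure lebesgue (ball x \<rho>)) \<longlongrightarrow> 1) (at_right 0)}"

text \<open>The boundary of a measurable set is the topological boundary of its set of points of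
  density one, so that it is unchanged by modifications on a null set.\<close>

definition density_frontier :: "'a::euclidean_space set \<Rightarrow> 'a set" where
  "density_frontier E = frontier (density_one E)"

definition Per :: "real \<Rightarrow> 'a::euclidean_space set \<Rightarrow> 'a set \<Rightarrow> ennreal" where
  "Per r E \<Omega> = emeasure lebesgue (ball_dilation (density_frontier E) r \<inter> \<Omega>) / ennreal (2 * r)"

text \<open>Since measurable sets are identified when they differ by a null set, the requirement that a
  competitor \<open>F\<close> agree with \<open>E\<close> outside the erosion of \<open>\<Omega>\<close> is imposed up to a null set.\<close>

definition Per_minimizer :: "real \<Rightarrow> 'a::euclidean_space set \<Rightarrow> 'a set \<Rightarrow> bool" where
  "Per_minimizer r \<Omega> E \<longleftrightarrow>
     E \<in> sets lebesgue \<and>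
     (\<forall>F\<in>sets lebesgue.
        sym_diff (F - ball_erosion \<Omega> r) (E - ball_erosion \<Omega> r) \<in> null_sets lebesgue
        \<longrightarrow> Per r E \<Omega> \<le> Per r F \<Omega>)"

definition bounded_domain :: "'a::euclidean_space set \<Rightarrow> bool" where
  "bounded_domain \<Omega> \<longleftrightarrow> open \<Omega> \<and> connected \<Omega> \<and> \<Omega> \<noteq> {} \<and> bounded \<Omega>"

end

theory Submission
  imports Defs
begin

text \<open>
  Let \<open>D\<close> be the set of points of density one of the minimizer \<open>E\<close> and let \<open>T\<close> be the open
  \<open>r\<close>-neighbourhood of the boundary of \<open>D\<close>, so that the perimeter of \<open>E\<close> is a multiple of the volume of
  \<open>T \<inter> \<Omega>\<close>. By the Lebesgue density theorem, \<open>D\<close> and \<open>E\<close> have the same mass in every ball. Only one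
  competitor is used, \<open>E\<close> minus the ball of radius \<open>R + r\<close>. The \<open>r\<close>-neighbourhood
  of its boundary does not meet \<open>B\<^bsub>R\<^esub>\<close>, and it can exceed \<open>T\<close> only at points of the annulus \<open>B\<^bsub>R + 2r\<^esub> - B\<^bsub>R\<^esub>\<close> that are within \<open>r\<close>
  of \<open>D\<close> but not of its boundary; such points have a whole \<open>r\<close>-ball inside \<open>D\<close>.
  Minimality therefore gives (\<open>Per_minimizer_dilation_in_ball_le\<close>) that the volume of \<open>T\<close> in \<open>B\<^bsub>R\<^esub>\<close> is at
  most the volume of \<open>D - T\<close> in the annulus, hence at most \<open>G\<close>, the mass of \<open>E\<close> in the annulus.

  This bound acts as an isoperimetric inequality. If \<open>A = D \<inter> B\<^bsub>R\<^esub>\<close> has mass \<open>\<omega>\<close>, a point of \<open>A\<close> that a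
  translation by a vector shorter than \<open>r\<close> moves out of \<open>A\<close> either lies in \<open>T \<inter> B\<^bsub>R\<^esub>\<close> or lands
  in \<open>D\<close> in the annulus, so these points have total mass at most \<open>2 G\<close>. The mass moved out is subadditive in the
  translation vector, so at most \<open>2 N G\<close> leaves for vectors shorter than \<open>N r\<close>. On the other hand, by Fubini's
  theorem, the overlap of \<open>A\<close> with its translates has integral at most \<open>\<omega>\<^sup>2\<close> over any set of vectors, so as soon as the ball of
  radius \<open>N r\<close> has volume above \<open>2 \<omega>\<close> some vector in it moves half of \<open>A\<close> out. Together
  \<open>\<omega> \<le> 4 N G\<close> (\<open>Per_minimizer_mass_le_annulus_mass\<close>).

  If the masses stay below \<open>C r\<^sup>n\<close>, one \<open>N\<close> serves for all radii and the mass grows geometrically, which is the last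
  claim. If \<open>\<omega>\<close> is at least a fixed multiple of \<open>r\<^sup>n\<close>, then \<open>N\<close> can be taken comparable to \<open>\<omega>\<^bsup>1/n\<^esup> / r\<close>, and
  \<open>\<omega>\<^bsup>1/n\<^esup>\<close> increases by a fixed multiple of \<open>r\<close>. If \<open>\<omega>\<close> is smaller, the comparison inequality shows that \<open>D\<close>
  contains a ball of radius \<open>r\<close> centred in \<open>B\<^bsub>R + 2r\<^esub>\<close> (\<open>Per_minimizer_contains_ball\<close>), which already makes the next mass
  comparable to \<open>r\<^sup>n\<close>. So the radius \<open>\<omega>\<^bsup>1/n\<^esup>\<close> grows linearly with a constant that depends on the dimension
  alone (\<open>mass_growth_uniform\<close>), and this settles the first three claims at once.
\<close>

section \<open>Points of density one\<close>

lemma measure_Int_Diff: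
  assumes "A \<in> fmeasurable M" "B \<in> sets M"
  shows "measure M A = measure M (A \<inter> B) + measure M (A - B)"
proof -
  have "A \<inter> B \<in> fmeasurable M" "A - B \<in> fmeasurable M"
    using fmeasurable_Int_fmeasurable[OF assms] assms by (auto simp: fmeasurable_Diff)
  moreover have "(A \<inter> B) \<union> (A - B) = A" "(A \<inter> B) \<inter> (A - B) = {}" by auto
  ultimately show ?thesis using measure_Un3[of "A \<inter> B" M "A - B"] by simp
qed

text \<open>Up to a remainder \<open>H\<close> of small measure, the complement of \<open>E\<close> is a closed set, which small balls around a point of
  \<open>E\<close> do not meet. The balls in question thus see the complement only through \<open>H\<close>, and a disjoint Vitali
  subfamily of them has total volume at most that of \<open>H\<close> divided by \<open>e\<close>.\<close>

lemma negligible_points_of_positive_complement_density: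
  fixes E :: "'a::euclidean_space set"
  assumes E: "E \<in> sets lebesgue" and e: "0 < e"
  shows "negligible {x \<in> E. \<forall>d>0. \<exists>\<rho>. 0 < \<rho> \<and> \<rho> < d \<and>
            e * measure lebesgue (ball x \<rho>) \<le> measure lebesgue (ball x \<rho> - E)}"
    (is "negligible ?S")
  unfolding negligible_outer_le
proof (intro allI impI)
  fix \<eta> :: real assume \<eta>: "0 < \<eta>"
  let ?\<mu> = "measure (lebesgue :: 'a measure)"
  have "- E \<in> sets lebesgue"
    using E by (simp add: Compl_in_sets_lebesgue)
  moreover have "0 < e * \<eta>" using e \<eta> by simp
  ultimately obtain C where C: "closed C" "C \<subseteq> - E" "- E - C \<in> lmeasurable"
      "emeasure lebesgue (- E - C) < ennreal (e * \<eta>)"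
    by (rule sets_lebesgue_inner_closed)
  have mC: "?\<mu> (- E - C) \<le> e * \<eta>"
    using C(3,4) e \<eta> by (simp add: emeasure_eq_measure2 ennreal_less_iff less_imp_le)
  let ?K = "{(x, \<rho>). 0 < \<rho> \<and> ball x \<rho> \<inter> C = {} \<and> e * ?\<mu> (ball x \<rho>) \<le> ?\<mu> (ball x \<rho> - E)}"
  obtain K where K: "countable K" "K \<subseteq> ?K"
      and pw: "pairwise (\<lambda>i j. disjnt (ball (fst i) (snd i)) (ball (fst j) (snd j))) K"
      and neg: "negligible (?S - (\<Union>i\<in>K. ball (fst i) (snd i)))"
  proof (rule Vitali_covering_theorem_balls [of ?S ?K fst snd])
    fix x and d :: real
    assume x: "x \<in> ?S" and d: "0 < d"
    have "x \<in> - C" using x C(2) by auto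
    then obtain k where k: "0 < k" "ball x k \<subseteq> - C"
      using C(1) open_contains_ball[of "- C"] by auto
    have "0 < min d k" using d k(1) by simp
    with x obtain \<rho> where \<rho>: "0 < \<rho>" "\<rho> < min d k" "e * ?\<mu> (ball x \<rho>) \<le> ?\<mu> (ball x \<rho> - E)"
      by blast
    moreover have "ball x \<rho> \<subseteq> ball x k" using \<rho>(2) by (intro subset_ball) simp
    ultimately show "\<exists>i. i \<in> ?K \<and> x \<in> ball (fst i) (snd i) \<and> snd i < d"
      using k(2) by (intro exI[of _ "(x, \<rho>)"]) auto
  qed
  let ?U = "\<Union>i\<in>K. ball (fst i) (snd i)"
  have bound: "?\<mu> (\<Union>i\<in>I. ball (fst i) (snd i)) \<le> \<eta>" if I: "I \<subseteq> K" "finite I" for I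
  proof -
    have pwI: "pairwise (\<lambda>i j. disjnt (ball (fst i) (snd i)) (ball (fst j) (snd j))) I"
      using pw I(1) by (rule pairwise_subset)
    have "e * ?\<mu> (\<Union>i\<in>I. ball (fst i) (snd i)) = (\<Sum>i\<in>I. e * ?\<mu> (ball (fst i) (snd i)))"
      using pwI I(2) by (subst measure_UNION') (auto simp: sum_distrib_left)
    also have "\<dots> \<le> (\<Sum>i\<in>I. ?\<mu> (ball (fst i) (snd i) - E))"
      using I(1) K(2) by (intro sum_mono) auto
    also have "\<dots> = ?\<mu> (\<Union>i\<in>I. ball (fst i) (snd i) - E)"
    proof (rule measure_UNION'[symmetric])
      show "pairwise (\<lambda>i j. disjnt (ball (fst i) (snd i) - E) (ball (fst j) (snd j) - E)) I"
        using pwI by (rule pairwise_mono) (auto simp: disjnt_def)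
    qed (use I(2) E in \<open>auto intro: fmeasurable.Int simp: fmeasurable_Diff\<close>)
    also have "\<dots> \<le> ?\<mu> (- E - C)"
    proof (rule measure_mono_fmeasurable)
      show "(\<Union>i\<in>I. ball (fst i) (snd i) - E) \<subseteq> - E - C"
        using I(1) K(2) by fastforce
      show "(\<Union>i\<in>I. ball (fst i) (snd i) - E) \<in> sets lebesgue"
        using I(2) E by (intro sets.finite_UN) auto
    qed (fact C(3))
    also have "\<dots> \<le> e * \<eta>" by (fact mC)
    finally show ?thesis using e by simp
  qed
  have U: "?U \<in> lmeasurable" "?\<mu> ?U \<le> \<eta>"
    using bound by (auto intro!: fmeasurable_UN_bound [OF K(1)] measure_UN_bound [OF K(1)])
  have "?\<mu> ((?S - ?U) \<union> ?U) = ?\<mu> ?U"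
    by (rule measure_negligible_symdiff[OF U(1)]) (rule negligible_subset[OF neg], auto)
  moreover have "(?S - ?U) \<union> ?U \<in> lmeasurable"
    by (intro fmeasurable.Un negligible_imp_measurable neg U(1))
  ultimately show "\<exists>T. ?S \<subseteq> T \<and> T \<in> lmeasurable \<and> ?\<mu> T \<le> \<eta>"
    using U(2) by (intro exI[of _ "(?S - ?U) \<union> ?U"] conjI) (blast | linarith)+
qed

lemma measure_ball_split:
  fixes E :: "'a::euclidean_space set"
  assumes "E \<in> sets lebesgue"
  shows "measure lebesgue (ball x \<rho>) =
           measure lebesgue (E \<inter> ball x \<rho>) + measure lebesgue (ball x \<rho> - E)"
  using measure_Int_Diff[OF lmeasurable_ball assms, of x \<rho>] by (simp add: Int_commute)

text \<open>Around a point without density one, the complement fills at least a fixed fraction \<open>1 / (n + 1)\<close> of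
  arbitrarily small balls.\<close>

lemma negligible_Diff_density_one:
  fixes E :: "'a::euclidean_space set"
  assumes E: "E \<in> sets lebesgue"
  shows "negligible (E - density_one E)"
proof -
  let ?\<mu> = "measure (lebesgue :: 'a measure)"
  let ?S = "\<lambda>e. {x \<in> E. \<forall>d>0. \<exists>\<rho>. 0 < \<rho> \<and> \<rho> < d \<and> e * ?\<mu> (ball x \<rho>) \<le> ?\<mu> (ball x \<rho> - E)}"
  have "negligible (\<Union>n. ?S (inverse (real (Suc n))))"
    by (intro negligible_Union_nat negligible_points_of_positive_complement_density E) simp
  moreover have "E - density_one E \<subseteq> (\<Union>n. ?S (inverse (real (Suc n))))"
  proof
    fix x assume x: "x \<in> E - density_one E"
    show "x \<in> (\<Union>n. ?S (inverse (real (Suc n))))"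
    proof (rule ccontr)
      assume contra: "x \<notin> (\<Union>n. ?S (inverse (real (Suc n))))"
      have "((\<lambda>\<rho>. ?\<mu> (E \<inter> ball x \<rho>) / ?\<mu> (ball x \<rho>)) \<longlongrightarrow> 1) (at_right 0)"
      proof (rule tendstoI)
        fix e :: real assume "0 < e"
        then obtain n where n: "inverse (real (Suc n)) < e" using reals_Archimedean by blast
        have "x \<notin> ?S (inverse (real (Suc n)))" using contra by blast
        with x obtain d where d: "0 < d"
          "\<And>\<rho>. 0 < \<rho> \<Longrightarrow> \<rho> < d \<Longrightarrow> ?\<mu> (ball x \<rho> - E) < inverse (real (Suc n)) * ?\<mu> (ball x \<rho>)"
          by (auto simp del: measure_completion simp: not_le)
        have "dist (?\<mu> (E \<inter> ball x \<rho>) / ?\<mu> (ball x \<rho>)) 1 < e" if \<rho>: "0 < \<rho>" "\<rho> < d" for \<rho>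
        proof -
          have pos: "0 < ?\<mu> (ball x \<rho>)" using \<rho> by (simp add: content_ball_pos)
          have "?\<mu> (E \<inter> ball x \<rho>) = ?\<mu> (ball x \<rho>) - ?\<mu> (ball x \<rho> - E)"
            using measure_ball_split[OF E, of x \<rho>] by linarith
          then have "?\<mu> (E \<inter> ball x \<rho>) / ?\<mu> (ball x \<rho>) = 1 - ?\<mu> (ball x \<rho> - E) / ?\<mu> (ball x \<rho>)"
            using pos by (metis diff_divide_distrib divide_self less_irrefl)
          then have "dist (?\<mu> (E \<inter> ball x \<rho>) / ?\<mu> (ball x \<rho>)) 1 = ?\<mu> (ball x \<rho> - E) / ?\<mu> (ball x \<rho>)"
            using pos by (simp add: dist_real_def)
          also have "\<dots> < inverse (real (Suc n))"
            using d(2)[OF \<rho>] pos by (simp add: divide_less_eq)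
          finally show ?thesis using n by simp
        qed
        then show "\<forall>\<^sub>F \<rho> in at_right 0. dist (?\<mu> (E \<inter> ball x \<rho>) / ?\<mu> (ball x \<rho>)) 1 < e"
          using d(1) by (intro eventually_at_rightI[of 0 d]) auto
      qed
      then show False using x by (simp add: density_one_def)
    qed
  qed
  ultimately show ?thesis by (rule negligible_subset)
qed

lemma density_one_Compl_disjoint:
  fixes E :: "'a::euclidean_space set"
  assumes E: "E \<in> sets lebesgue"
  shows "density_one E \<inter> density_one (- E) = {}"
proof (rule ccontr)
  let ?\<mu> = "measure (lebesgue :: 'a measure)"
  assume "density_one E \<inter> density_one (- E) \<noteq> {}"
  then obtain x where x: "x \<in> density_one E" "x \<in> density_one (- E)" by auto
  have "((\<lambda>\<rho>. ?\<mu> (E \<inter> ball x \<rho>) / ?\<mu> (ball x \<rho>) + ?\<mu> (- E \<inter> ball x \<rho>) / ?\<mu> (ball x \<rho>)) \<longlongrightarrow> 1 + 1)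
          (at_right 0)"
    using x unfolding density_one_def by (intro tendsto_add) auto
  moreover have "\<forall>\<^sub>F \<rho> in at_right 0.
      ?\<mu> (E \<inter> ball x \<rho>) / ?\<mu> (ball x \<rho>) + ?\<mu> (- E \<inter> ball x \<rho>) / ?\<mu> (ball x \<rho>) = 1"
  proof (rule eventually_at_rightI[of 0 1])
    fix \<rho> :: real assume "\<rho> \<in> {0<..<1}"
    then have "0 < ?\<mu> (ball x \<rho>)" by (simp add: content_ball_pos)
    moreover have "- E \<inter> ball x \<rho> = ball x \<rho> - E" by auto
    ultimately show "?\<mu> (E \<inter> ball x \<rho>) / ?\<mu> (ball x \<rho>) + ?\<mu> (- E \<inter> ball x \<rho>) / ?\<mu> (ball x \<rho>) = 1"
      using measure_ball_split[OF E, of x \<rho>] by (simp add: add_divide_distrib[symmetric])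
  qed simp
  from tendsto_eventually[OF this]
  have "((\<lambda>\<rho>. ?\<mu> (E \<inter> ball x \<rho>) / ?\<mu> (ball x \<rho>) + ?\<mu> (- E \<inter> ball x \<rho>) / ?\<mu> (ball x \<rho>)) \<longlongrightarrow> 1)
          (at_right 0)" .
  ultimately have "(1 :: real) + 1 = 1"
    by (rule tendsto_unique[OF trivial_limit_at_right_real])
  then show False by simp
qed

text \<open>The two halves of the symmetric difference are the same statement for \<open>E\<close> and for its complement.\<close>

theorem Lebesgue_density:
  fixes E :: "'a::euclidean_space set"
  assumes E: "E \<in> sets lebesgue"
  shows "negligible (sym_diff E (density_one E))"
proof -
  have "negligible (- E - density_one (- E))"
    using E by (intro negligible_Diff_density_one) (simp add: Compl_in_sets_lebesgue)
  then have "negligible (density_one E - E)"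
    by (rule negligible_subset) (use density_one_Compl_disjoint[OF E] in auto)
  then show ?thesis
    using negligible_Diff_density_one[OF E] by (rule negligible_Un[rotated])
qed

lemma measure_density_one_Int:
  fixes E S :: "'a::euclidean_space set"
  assumes E: "E \<in> sets lebesgue" and S: "S \<in> lmeasurable"
  shows "density_one E \<inter> S \<in> lmeasurable"
    and "measure lebesgue (density_one E \<inter> S) = measure lebesgue (E \<inter> S)"
proof -
  have ES: "E \<inter> S \<in> lmeasurable"
    using fmeasurable_Int_fmeasurable[OF S E] by (simp add: Int_commute)
  have neg: "negligible (sym_diff (E \<inter> S) (density_one E \<inter> S))"
    by (rule negligible_subset[OF Lebesgue_density[OF E]]) auto
  show "density_one E \<inter> S \<in> lmeasurable"
    using lmeasurable_negligible_symdiff[OF ES neg] .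
  show "measure lebesgue (density_one E \<inter> S) = measure lebesgue (E \<inter> S)"
    using measure_negligible_symdiff[OF ES neg] .
qed

lemma open_ball_dilation: "open (ball_dilation A r)"
  unfolding ball_dilation_def by auto

lemma mem_ball_dilation: "x \<in> ball_dilation A r \<longleftrightarrow> (\<exists>y\<in>A. dist y x < r)"
  by (auto simp: ball_dilation_def)

text \<open>A ball is connected, so it cannot meet both \<open>D\<close> and its complement while avoiding the frontier.\<close>

lemma ball_subset_of_far_from_frontier:
  fixes D :: "'a::euclidean_space set"
  assumes "x \<notin> ball_dilation (frontier D) r" "ball x r \<inter> D \<noteq> {}"
  shows "ball x r \<subseteq> D"
proof (rule ccontr)
  assume "\<not> ball x r \<subseteq> D"
  then have "ball x r \<inter> frontier D \<noteq> {}"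
    using assms(2) by (intro connected_Int_frontier) auto
  then show False using assms(1) by (auto simp: mem_ball_dilation dist_commute)
qed

lemma density_one_cong_near:
  assumes "0 < d" "E \<inter> ball x d = F \<inter> ball x d"
  shows "x \<in> density_one E \<longleftrightarrow> x \<in> density_one F"
proof -
  have "\<forall>\<^sub>F \<rho> in at_right 0.
      measure lebesgue (E \<inter> ball x \<rho>) / measure lebesgue (ball x \<rho>) =
      measure lebesgue (F \<inter> ball x \<rho>) / measure lebesgue (ball x \<rho>)"
  proof (rule eventually_at_rightI[of 0 d])
    fix \<rho> assume "\<rho> \<in> {0<..<d}"
    then have "ball x \<rho> \<subseteq> ball x d" by (intro subset_ball) simp
    then have "E \<inter> ball x \<rho> = F \<inter> ball x \<rho>" using assms(2) by blast
    then show "measure lebesgue (E \<inter> ball x \<rho>) / measure lebesgue (ball x \<rho>) =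
      measure lebesgue (F \<inter> ball x \<rho>) / measure lebesgue (ball x \<rho>)" by simp
  qed (fact assms(1))
  then show ?thesis
    unfolding density_one_def by (simp add: tendsto_cong)
qed

lemma density_one_mono:
  fixes E F :: "'a::euclidean_space set"
  assumes F: "F \<in> sets lebesgue" and E: "E \<in> sets lebesgue" and FE: "F \<subseteq> E"
  shows "density_one F \<subseteq> density_one E"
proof
  let ?\<mu> = "measure (lebesgue :: 'a measure)"
  fix x assume "x \<in> density_one F"
  then have lim: "((\<lambda>\<rho>. ?\<mu> (F \<inter> ball x \<rho>) / ?\<mu> (ball x \<rho>)) \<longlongrightarrow> 1) (at_right 0)"
    by (simp add: density_one_def)
  have meas: "A \<inter> ball x \<rho> \<in> lmeasurable" if "A \<in> sets lebesgue" for A \<rho>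
    using fmeasurable_Int_fmeasurable[OF lmeasurable_ball that] by (simp add: Int_commute)
  have "?\<mu> (F \<inter> ball x \<rho>) \<le> ?\<mu> (E \<inter> ball x \<rho>)" for \<rho>
    using FE meas[OF E] meas[OF F] by (intro measure_mono_fmeasurable) auto
  then have lower: "?\<mu> (F \<inter> ball x \<rho>) / ?\<mu> (ball x \<rho>) \<le> ?\<mu> (E \<inter> ball x \<rho>) / ?\<mu> (ball x \<rho>)" for \<rho>
    by (intro divide_right_mono) auto
  have "?\<mu> (E \<inter> ball x \<rho>) \<le> ?\<mu> (ball x \<rho>)" for \<rho>
    using meas[OF E] by (intro measure_mono_fmeasurable) auto
  then have upper: "?\<mu> (E \<inter> ball x \<rho>) / ?\<mu> (ball x \<rho>) \<le> 1" for \<rho>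
    by (intro divide_le_eq_1[THEN iffD2]) (smt (verit) measure_nonneg)
  show "x \<in> density_one E"
    unfolding density_one_def
    using tendsto_sandwich[OF _ _ lim tendsto_const] lower upper by (simp add: always_eventually)
qed

lemma density_one_empty_near:
  assumes "0 < d" "E \<inter> ball x d = {}"
  shows "x \<notin> density_one E"
proof -
  have "x \<in> density_one E \<longleftrightarrow> x \<in> density_one ({} :: 'a set)"
    using assms by (intro density_one_cong_near) auto
  then show ?thesis by (simp add: density_one_def tendsto_const_iff)
qed

lemma frontier_cong_near:
  assumes S: "open S" "x \<in> S" and eq: "A \<inter> S = B \<inter> S"
  shows "x \<in> frontier A \<longleftrightarrow> x \<in> frontier B"
proof -
  have "x \<in> closure B'" if "x \<in> closure A'" "A' \<inter> S = B' \<inter> S" for A' B'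
  proof -
    have "x \<in> closure (B' \<inter> S)"
      using open_Int_closure_subset[OF S(1), of A'] S(2) that by (auto simp: Int_commute)
    then show ?thesis using closure_mono[of "B' \<inter> S" B'] by auto
  qed
  moreover have "- A \<inter> S = - B \<inter> S" using eq by auto
  ultimately show ?thesis
    unfolding frontier_closures using eq by (metis Int_iff)
qed

text \<open>Removing a ball creates new boundary only on the bounding sphere, and there only where \<open>E\<close> accumulates:
  inside the ball nothing is left, and outside it the set is unchanged near every point.\<close>

lemma frontier_density_one_remove_ball:
  fixes E :: "'a::euclidean_space set"
  assumes E: "E \<in> sets lebesgue"
    and y: "y \<in> frontier (density_one (E - ball 0 \<rho>))"
  shows "\<rho> \<le> norm y"
    and "\<rho> < norm y \<Longrightarrow> y \<in> frontier (density_one E)"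
    and "y \<in> closure (density_one E)"
proof -
  let ?F = "E - ball 0 \<rho>"
  have F: "?F \<in> sets lebesgue" using E by auto
  show "\<rho> \<le> norm y"
  proof (rule ccontr)
    assume "\<not> \<rho> \<le> norm y"
    then have yb: "y \<in> ball 0 \<rho>" by simp
    have "ball 0 \<rho> \<inter> density_one ?F = {}"
    proof -
      have "x \<notin> density_one ?F" if "x \<in> ball 0 \<rho>" for x
      proof -
        obtain d where "0 < d" "ball x d \<subseteq> ball 0 \<rho>"
          using openE[OF open_ball \<open>x \<in> ball 0 \<rho>\<close>] by blast
        then show ?thesis by (intro density_one_empty_near[of d]) auto
      qed
      then show ?thesis by auto
    qed
    then have "ball 0 \<rho> \<inter> closure (density_one ?F) = {}"
      using open_Int_closure_eq_empty[OF open_ball] by blast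
    then show False using y yb by (auto simp: frontier_def)
  qed
  show "y \<in> frontier (density_one E)" if "\<rho> < norm y"
  proof -
    have op: "open (- cball (0::'a) \<rho>)" by (intro open_Compl closed_cball)
    have "x \<in> density_one ?F \<longleftrightarrow> x \<in> density_one E" if "x \<in> - cball 0 \<rho>" for x
    proof -
      obtain d where "0 < d" "ball x d \<subseteq> - cball 0 \<rho>"
        using openE[OF op \<open>x \<in> - cball 0 \<rho>\<close>] by blast
      then show ?thesis by (intro density_one_cong_near[of d]) auto
    qed
    then have "density_one ?F \<inter> - cball 0 \<rho> = density_one E \<inter> - cball 0 \<rho>" by blast
    moreover have "y \<in> - cball 0 \<rho>" using that by simp
    ultimately show ?thesis
      using frontier_cong_near[OF op] y by blast
  qed
  have "closure (density_one ?F) \<subseteq> closure (density_one E)"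
    using density_one_mono[OF F E] by (intro closure_mono) auto
  then show "y \<in> closure (density_one E)" using y by (auto simp: frontier_def)
qed

section \<open>Translates that leave a set\<close>

text \<open>Exchanging the order of integration, each \<open>x \<in> B\<close> contributes at most the volume of \<open>B\<close>, by translation
  invariance.\<close>

lemma nn_integral_overlap_with_translates:
  fixes B S :: "'a::euclidean_space set"
  assumes [measurable]: "B \<in> sets borel" "S \<in> sets borel"
  shows "(\<integral>\<^sup>+h\<in>S. emeasure lborel {x \<in> B. x + h \<in> B} \<partial>lborel) \<le> emeasure lborel B * emeasure lborel B"
proof -
  have "(\<integral>\<^sup>+h\<in>S. emeasure lborel {x \<in> B. x + h \<in> B} \<partial>lborel)
      = (\<integral>\<^sup>+h. (\<integral>\<^sup>+x. indicator B x * indicator B (x + h) * indicator S h \<partial>lborel) \<partial>lborel)"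
  proof (rule nn_integral_cong)
    fix h
    have "emeasure lborel {x \<in> B. x + h \<in> B} * indicator S h
        = (\<integral>\<^sup>+x. indicator {x \<in> B. x + h \<in> B} x \<partial>lborel) * indicator S h"
      by simp
    also have "\<dots> = (\<integral>\<^sup>+x. indicator {x \<in> B. x + h \<in> B} x * indicator S h \<partial>lborel)"
      by (rule nn_integral_multc[symmetric]) measurable
    also have "\<dots> = (\<integral>\<^sup>+x. indicator B x * indicator B (x + h) * indicator S h \<partial>lborel)"
      by (intro nn_integral_cong) (auto simp: indicator_def)
    finally show "emeasure lborel {x \<in> B. x + h \<in> B} * indicator S h
        = (\<integral>\<^sup>+x. indicator B x * indicator B (x + h) * indicator S h \<partial>lborel)" .
  qed
  also have "\<dots> = (\<integral>\<^sup>+x. (\<integral>\<^sup>+h. indicator B x * indicator B (x + h) * indicator S h \<partial>lborel) \<partial>lborel)"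
    by (rule lborel_pair.Fubini') measurable
  also have "\<dots> \<le> (\<integral>\<^sup>+x. indicator B x * emeasure lborel B \<partial>lborel)"
  proof (rule nn_integral_mono)
    fix x
    have "(\<integral>\<^sup>+h. indicator B x * indicator B (x + h) * indicator S h \<partial>lborel)
        \<le> (\<integral>\<^sup>+h. indicator B x * indicator B (x + h) \<partial>lborel)"
      by (intro nn_integral_mono) (auto simp: indicator_def)
    also have "\<dots> = indicator B x * (\<integral>\<^sup>+h. indicator B (x + h) \<partial>lborel)"
      by (rule nn_integral_cmult) measurable
    also have "(\<integral>\<^sup>+h. indicator B (x + h) \<partial>lborel) = (\<integral>\<^sup>+y. indicator B y \<partial>distr lborel borel ((+) x))"
      by (subst nn_integral_distr) auto
    also have "\<dots> = emeasure lborel B" by (simp add: lborel_distr_plus)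
    finally show "(\<integral>\<^sup>+h. indicator B x * indicator B (x + h) * indicator S h \<partial>lborel)
        \<le> indicator B x * emeasure lborel B" .
  qed
  also have "\<dots> = emeasure lborel B * emeasure lborel B"
    by (subst nn_integral_multc) auto
  finally show ?thesis .
qed

lemma translate_escape_eq: "{x \<in> A. x + h \<notin> A} = A - (+) (- h) ` (A :: 'a::ab_group_add set)"
proof -
  have "x + h \<in> A \<longleftrightarrow> x \<in> (+) (- h) ` A" for x
    by (auto simp: image_iff intro!: bexI[of _ "x + h"])
  then show ?thesis by auto
qed

lemma lmeasurable_translate_escape:
  fixes A :: "'a::euclidean_space set"
  assumes "A \<in> lmeasurable"
  shows "{x \<in> A. x + h \<notin> A} \<in> lmeasurable"
  using assms measurable_translation[OF assms, of "- h"]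
  by (auto simp: translate_escape_eq fmeasurable_Diff)

text \<open>A point that leaves \<open>A\<close> after \<open>N + 1\<close> steps of length \<open>h\<close> has left it after \<open>N\<close> steps, or leaves it in the last
  one.\<close>

lemma measure_translate_escape_multiple:
  fixes A :: "'a::euclidean_space set"
  assumes A: "A \<in> lmeasurable"
  shows "measure lebesgue {x \<in> A. x + real N *\<^sub>R h \<notin> A} \<le> real N * measure lebesgue {x \<in> A. x + h \<notin> A}"
proof (induction N)
  case (Suc N)
  let ?V = "\<lambda>h. {x \<in> A. x + h \<notin> A}"
  let ?W = "(+) (- (real N *\<^sub>R h)) ` ?V h"
  have V: "?V h \<in> lmeasurable" for h by (rule lmeasurable_translate_escape[OF A])
  have W: "?W \<in> lmeasurable" by (rule measurable_translation[OF V])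
  have "?V (real (Suc N) *\<^sub>R h) \<subseteq> ?V (real N *\<^sub>R h) \<union> ?W"
    by (auto simp: image_iff algebra_simps intro!: exI[of _ "_ + real N *\<^sub>R h"])
  then have "measure lebesgue (?V (real (Suc N) *\<^sub>R h)) \<le> measure lebesgue (?V (real N *\<^sub>R h) \<union> ?W)"
    using V W by (intro measure_mono_fmeasurable) auto
  also have "\<dots> \<le> measure lebesgue (?V (real N *\<^sub>R h)) + measure lebesgue ?W"
    using V W by (intro measure_Un_le) auto
  also have "measure lebesgue ?W = measure lebesgue (?V h)" by (rule measure_translation)
  finally show ?case using Suc by (simp add: algebra_simps)
qed simp

text \<open>Otherwise every translate by a vector of \<open>S\<close> overlaps \<open>B\<close> in at least half of its volume \<open>b\<close>, and
  integrating over \<open>S\<close> gives \<open>b / 2 * s \<le> b\<^sup>2\<close> for the volume \<open>s\<close> of \<open>S\<close>.\<close>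

lemma exists_translate_escaping_half_borel:
  fixes B S :: "'a::euclidean_space set"
  assumes B: "B \<in> sets borel" "B \<in> lmeasurable" and S: "S \<in> sets borel" "S \<in> lmeasurable"
    and less: "2 * measure lebesgue B < measure lebesgue S"
  shows "\<exists>h\<in>S. measure lebesgue B \<le> 2 * measure lebesgue {x \<in> B. x + h \<notin> B}"
proof (rule ccontr)
  let ?b = "measure lebesgue B" and ?s = "measure lebesgue S"
  assume "\<not> ?thesis"
  then have small: "2 * measure lebesgue {x \<in> B. x + h \<notin> B} < ?b" if "h \<in> S" for h
    using that by force
  have em: "emeasure lborel X = ennreal (measure lebesgue X)" if "X \<in> sets borel" "X \<in> lmeasurable" for X :: "'a set"
  proof -
    have "emeasure lebesgue X = emeasure lborel X" using that(1) by simp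
    then show ?thesis using emeasure_eq_measure2[OF that(2)] by simp
  qed
  have half: "ennreal (?b / 2) \<le> emeasure lborel {x \<in> B. x + h \<in> B}" if h: "h \<in> S" for h
  proof -
    have meas: "{x \<in> B. x + h \<in> B} \<in> sets borel" using B(1) by measurable
    have lm: "{x \<in> B. x + h \<in> B} \<in> lmeasurable"
      by (rule fmeasurableI2[OF B(2)]) (use meas in auto)
    have "B - {x \<in> B. x + h \<in> B} = {x \<in> B. x + h \<notin> B}" "B \<inter> {x \<in> B. x + h \<in> B} = {x \<in> B. x + h \<in> B}" by auto
    then have "?b = measure lebesgue {x \<in> B. x + h \<in> B} + measure lebesgue {x \<in> B. x + h \<notin> B}"
      using measure_Int_Diff[OF B(2), of "{x \<in> B. x + h \<in> B}"] lm by auto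
    then show ?thesis
      using small[OF h] em[OF meas lm] by (auto intro!: ennreal_leI)
  qed
  have "ennreal (?b / 2) * ennreal ?s = (\<integral>\<^sup>+h\<in>S. ennreal (?b / 2) \<partial>lborel)"
    using S em[OF S] by (subst nn_integral_cmult_indicator) auto
  also have "\<dots> \<le> (\<integral>\<^sup>+h\<in>S. emeasure lborel {x \<in> B. x + h \<in> B} \<partial>lborel)"
    using half by (intro nn_integral_mono) (auto simp: indicator_def)
  also have "\<dots> \<le> ennreal ?b * ennreal ?b"
    using nn_integral_overlap_with_translates[OF B(1) S(1)] em[OF B] by simp
  finally have "?b / 2 * ?s \<le> ?b * ?b"
    by (simp flip: ennreal_mult)
  moreover have "0 < ?s" using less measure_nonneg[of lebesgue B] by linarith
  then obtain h where "h \<in> S" by (metis all_not_in_conv less_irrefl measure_empty)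
  then have "0 < ?b" using small[of h] measure_nonneg[of lebesgue "{x \<in> B. x + h \<notin> B}"] by linarith
  ultimately show False using less by (simp add: field_simps)
qed

lemma exists_translate_escaping_half:
  fixes A S :: "'a::euclidean_space set"
  assumes A: "A \<in> lmeasurable" and S: "S \<in> sets borel" "S \<in> lmeasurable"
    and less: "2 * measure lebesgue A < measure lebesgue S"
  shows "\<exists>h\<in>S. measure lebesgue A \<le> 2 * measure lebesgue {x \<in> A. x + h \<notin> A}"
proof -
  obtain B N N' where ABN: "A = B \<union> N" "N \<subseteq> N'" "N' \<in> null_sets lborel" "B \<in> sets lborel"
    using A by (auto simp: fmeasurable_def elim: sets_completionE)
  have N: "negligible N"
    using ABN(2,3) negligible_subset[of N' N] null_sets_completionI[of N' lborel]
    by (simp add: negligible_iff_null_sets)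
  have neg: "negligible (sym_diff A B)"
    by (rule negligible_subset[OF N]) (use ABN(1) in auto)
  have B: "B \<in> sets borel" "B \<in> lmeasurable" "measure lebesgue B = measure lebesgue A"
    using ABN(4) lmeasurable_negligible_symdiff[OF A neg] measure_negligible_symdiff[OF A neg] by auto
  then obtain h where h: "h \<in> S" "measure lebesgue A \<le> 2 * measure lebesgue {x \<in> B. x + h \<notin> B}"
    using exists_translate_escaping_half_borel[OF B(1,2) S] less by auto
  let ?V = "\<lambda>A. {x \<in> A. x + h \<notin> A}"
  let ?W = "(+) (- h) ` N"
  have V: "?V A \<in> lmeasurable" "?V B \<in> lmeasurable"
    using lmeasurable_translate_escape A B(2) by auto
  have W: "negligible ?W" using N by (rule negligible_translation)
  have "x + h \<in> N \<Longrightarrow> x \<in> ?W" for x by (auto intro!: image_eqI[of _ _ "x + h"])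
  then have "?V B \<subseteq> ?V A \<union> ?W" using ABN(1) by auto
  then have "measure lebesgue (?V B) \<le> measure lebesgue (?V A \<union> ?W)"
    using V W by (intro measure_mono_fmeasurable) (auto intro: negligible_imp_measurable)
  also have "\<dots> \<le> measure lebesgue (?V A) + measure lebesgue ?W"
    using V W by (intro measure_Un_le) (auto intro: negligible_imp_sets)
  also have "measure lebesgue ?W = 0" using W by (rule negligible_imp_measure0)
  finally show ?thesis using h by force
qed

text \<open>An isoperimetric inequality: the mass that short translations move out of \<open>A\<close> plays the role of the perimeter. A
  vector in the ball of radius \<open>N r\<close> that moves half of \<open>A\<close> out is divided into \<open>N\<close> equal steps shorter than \<open>r\<close>.\<close>

lemma measure_le_of_short_translates:
  fixes A :: "'a::euclidean_space set"
  assumes A: "A \<in> lmeasurable" and N: "0 < N"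
    and big: "2 * measure lebesgue A < measure lebesgue (ball (0::'a) (real N * r))"
    and short: "\<And>h. norm h < r \<Longrightarrow> measure lebesgue {x \<in> A. x + h \<notin> A} \<le> b"
  shows "measure lebesgue A \<le> 2 * real N * b"
proof -
  obtain h where h: "h \<in> ball 0 (real N * r)" "measure lebesgue A \<le> 2 * measure lebesgue {x \<in> A. x + h \<notin> A}"
    using exists_translate_escaping_half[OF A _ lmeasurable_ball big] by auto
  define k where "k = h /\<^sub>R real N"
  have hk: "h = real N *\<^sub>R k" using N by (simp add: k_def)
  have "norm k < r" using h(1) N by (simp add: hk)
  then have "measure lebesgue {x \<in> A. x + h \<notin> A} \<le> real N * b"
    using measure_translate_escape_multiple[OF A, of N k] short[of k] mult_left_mono[of _ b "real N"]
    unfolding hk by fastforce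
  then show ?thesis using h(2) by simp
qed

section \<open>Removing a ball from a minimizer\<close>

text \<open>This is what makes the removal of a ball of radius \<open>R + r\<close> an admissible change.\<close>

lemma ball_subset_ball_erosion:
  fixes \<Omega> :: "'a::euclidean_space set"
  assumes "open \<Omega>" "ball 0 (R + 2 * r) \<subseteq> \<Omega>" "0 < r"
  shows "ball 0 (R + r) \<subseteq> ball_erosion \<Omega> r"
proof
  fix x :: 'a assume x: "x \<in> ball 0 (R + r)"
  have "\<not> dist y x < r" if y: "y \<in> frontier \<Omega>" for y
  proof
    assume "dist y x < r"
    then have "norm y < R + 2 * r"
      using x norm_triangle_ineq2[of y x] by (simp add: dist_norm)
    then have "y \<in> \<Omega>" using assms(2) by auto
    then show False using y assms(1) frontier_disjoint_eq by blast
  qed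
  moreover have "x \<in> \<Omega>" using x assms(2,3) by auto
  ultimately show "x \<in> ball_erosion \<Omega> r"
    by (auto simp: ball_erosion_def mem_ball_dilation)
qed

lemma Per_minimizer_measure_dilation_le:
  fixes \<Omega> E F :: "'a::euclidean_space set"
  assumes \<Omega>: "bounded_domain \<Omega>" and min: "Per_minimizer r \<Omega> E" and r: "0 < r"
    and F: "F \<in> sets lebesgue" "F - ball_erosion \<Omega> r = E - ball_erosion \<Omega> r"
  shows "measure lebesgue (ball_dilation (density_frontier E) r \<inter> \<Omega>)
       \<le> measure lebesgue (ball_dilation (density_frontier F) r \<inter> \<Omega>)"
proof -
  have lm: "ball_dilation A r \<inter> \<Omega> \<in> lmeasurable" for A
    using \<Omega> by (intro lmeasurable_open) (auto simp: bounded_domain_def open_ball_dilation)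
  have "Per r E \<Omega> \<le> Per r F \<Omega>"
    using min F by (auto simp: Per_minimizer_def)
  then show ?thesis
    using r emeasure_eq_measure2[OF lm] by (simp add: Per_def divide_ennreal divide_le_cancel)
qed

text \<open>The comparison with \<open>E\<close> minus the ball of radius \<open>R + r\<close>. Everything that happens outside \<open>B\<^bsub>R\<^esub>\<close> and inside the
  neighbourhood of the old boundary cancels, since \<open>\<Omega>\<close> has finite measure. On the left remains the part of the old
  neighbourhood in \<open>B\<^bsub>R\<^esub>\<close>; on the right, at most the points of the annulus that are close to the new boundary
  but not to the old one, and these lie in the interior of \<open>D\<close>.\<close>

lemma Per_minimizer_dilation_in_ball_le:
  fixes \<Omega> E :: "'a::euclidean_space set"
  defines "D \<equiv> density_one E"
  assumes \<Omega>: "bounded_domain \<Omega>" and min: "Per_minimizer r \<Omega> E" and r: "0 < r"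
    and sub: "ball 0 (R + 2 * r) \<subseteq> \<Omega>"
  shows "measure lebesgue (ball_dilation (frontier D) r \<inter> ball 0 R)
       \<le> measure lebesgue (D \<inter> (ball 0 (R + 2 * r) - ball 0 R) - ball_dilation (frontier D) r)"
proof -
  let ?\<mu> = "measure (lebesgue :: 'a measure)"
  define F where "F = E - ball 0 (R + r)"
  define T where "T = ball_dilation (frontier D) r"
  define TF where "TF = ball_dilation (frontier (density_one F)) r"
  let ?X = "D \<inter> (ball 0 (R + 2 * r) - ball 0 R) - T"
  have E: "E \<in> sets lebesgue" using min by (simp add: Per_minimizer_def)
  have \<Omega>': "open \<Omega>" "bounded \<Omega>" using \<Omega> by (auto simp: bounded_domain_def)
  have T: "open T" unfolding T_def by (rule open_ball_dilation)
  have T\<Omega>: "T \<inter> \<Omega> \<in> lmeasurable" using T \<Omega>' by (intro lmeasurable_open) auto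
  have "D \<inter> (ball 0 (R + 2 * r) - ball 0 R) \<in> lmeasurable"
    unfolding D_def by (intro measure_density_one_Int(1)[OF E] fmeasurable_Diff) auto
  then have X: "?X \<in> lmeasurable" using T by (intro fmeasurable_Diff) auto
  have F: "F \<in> sets lebesgue" unfolding F_def using E by (intro sets.Diff) auto
  have "F - ball_erosion \<Omega> r = E - ball_erosion \<Omega> r"
    using ball_subset_ball_erosion[OF \<Omega>'(1) sub r] by (auto simp: F_def)
  then have le: "?\<mu> (T \<inter> \<Omega>) \<le> ?\<mu> (TF \<inter> \<Omega>)"
    using Per_minimizer_measure_dilation_le[OF \<Omega> min r F]
    by (simp add: T_def TF_def D_def density_frontier_def)
  have "TF \<inter> \<Omega> \<subseteq> (T \<inter> \<Omega> - ball 0 R) \<union> ?X"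
  proof
    fix x assume x: "x \<in> TF \<inter> \<Omega>"
    then obtain y where y: "y \<in> frontier (density_one F)" "dist y x < r"
      by (auto simp: TF_def mem_ball_dilation)
    note yF = frontier_density_one_remove_ball[OF E y(1)[unfolded F_def], folded D_def]
    have far: "x \<notin> ball 0 R"
      using yF(1) y(2) norm_triangle_ineq2[of y x] by (auto simp: dist_norm)
    show "x \<in> (T \<inter> \<Omega> - ball 0 R) \<union> ?X"
    proof (cases "x \<in> T")
      case False
      then have "y \<notin> frontier D" using y(2) by (auto simp: T_def mem_ball_dilation)
      \<comment> \<open>so \<open>y\<close> belongs to the boundary created by the removal\<close>
      then have "norm y = R + r" using yF(1,2) by fastforce
      then have "norm x < R + 2 * r"
        using y(2) norm_triangle_ineq2[of x y] by (simp add: dist_norm norm_minus_commute)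
      moreover have "y \<in> ball x r" using y(2) by (simp add: dist_commute)
      then have "ball x r \<inter> D \<noteq> {}"
        using yF(3) open_Int_closure_eq_empty[OF open_ball] by blast
      then have "ball x r \<subseteq> D"
        using False unfolding T_def by (rule ball_subset_of_far_from_frontier[rotated])
      then have "x \<in> D" using r by auto
      ultimately show ?thesis using False far by simp
    qed (use x far in auto)
  qed
  then have "?\<mu> (TF \<inter> \<Omega>) \<le> ?\<mu> ((T \<inter> \<Omega> - ball 0 R) \<union> ?X)"
    using T\<Omega> X \<Omega>' by (intro measure_mono_fmeasurable)
      (auto intro!: fmeasurable.Un fmeasurable_Diff simp: TF_def open_ball_dilation)
  also have "\<dots> \<le> ?\<mu> (T \<inter> \<Omega> - ball 0 R) + ?\<mu> ?X"
    using T\<Omega> X by (intro measure_Un_le) auto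
  finally have "?\<mu> (T \<inter> \<Omega>) \<le> ?\<mu> (T \<inter> \<Omega> - ball 0 R) + ?\<mu> ?X"
    using le by linarith
  moreover have "?\<mu> (T \<inter> \<Omega>) = ?\<mu> (T \<inter> \<Omega> \<inter> ball 0 R) + ?\<mu> (T \<inter> \<Omega> - ball 0 R)"
    using T\<Omega> by (rule measure_Int_Diff) simp
  moreover have "ball 0 R \<subseteq> \<Omega>" using sub r by (auto simp: subset_iff)
  then have "T \<inter> \<Omega> \<inter> ball 0 R = T \<inter> ball 0 R" by auto
  ultimately show ?thesis by (simp add: T_def)
qed

text \<open>The isoperimetric inequality \<open>measure_le_of_short_translates\<close> for the part of \<open>E\<close> in \<open>B\<^bsub>R\<^esub>\<close>. What a short translation
  moves out of it is charged either to the neighbourhood of the boundary or to the annulus, and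
  both are bounded by the mass in the annulus.\<close>

lemma Per_minimizer_mass_le_annulus_mass:
  fixes \<Omega> E :: "'a::euclidean_space set"
  assumes \<Omega>: "bounded_domain \<Omega>" and min: "Per_minimizer r \<Omega> E" and r: "0 < r"
    and sub: "ball 0 (R + 2 * r) \<subseteq> \<Omega>" and N: "0 < N"
    and big: "2 * measure lebesgue (E \<inter> ball 0 R) < measure lebesgue (ball (0::'a) (real N * r))"
  shows "measure lebesgue (E \<inter> ball 0 R)
       \<le> 4 * real N * measure lebesgue (E \<inter> (ball 0 (R + 2 * r) - ball 0 R))"
proof -
  let ?\<mu> = "measure (lebesgue :: 'a measure)"
  define D where "D = density_one E"
  define T where "T = ball_dilation (frontier D) r"
  let ?A = "D \<inter> ball 0 R" and ?G = "D \<inter> (ball 0 (R + 2 * r) - ball 0 R)"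
  have E: "E \<in> sets lebesgue" using min by (simp add: Per_minimizer_def)
  have ann: "ball (0::'a) (R + 2 * r) - ball 0 R \<in> lmeasurable" by (intro fmeasurable_Diff) auto
  note A = measure_density_one_Int[OF E lmeasurable_ball, of 0 R, folded D_def]
  note G = measure_density_one_Int[OF E ann, folded D_def]
  have T: "open T" unfolding T_def by (rule open_ball_dilation)
  have TR: "T \<inter> ball 0 R \<in> lmeasurable" using T by (intro lmeasurable_open) auto
  have "?\<mu> (T \<inter> ball 0 R) \<le> ?\<mu> (?G - T)"
    using Per_minimizer_dilation_in_ball_le[OF \<Omega> min r sub] by (simp add: T_def D_def)
  also have "\<dots> \<le> ?\<mu> ?G"
    using G(1) T by (intro measure_mono_fmeasurable) auto
  finally have TG: "?\<mu> (T \<inter> ball 0 R) \<le> ?\<mu> ?G" .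
  have "?\<mu> ?A \<le> 2 * real N * (2 * ?\<mu> ?G)"
  proof (rule measure_le_of_short_translates[OF A(1) N])
    show "2 * ?\<mu> ?A < ?\<mu> (ball 0 (real N * r))" using big A(2) by simp
  next
    fix h :: 'a assume h: "norm h < r"
    let ?W = "(+) (- h) ` ?G"
    have W: "?W \<in> lmeasurable" using G(1) by (rule measurable_translation)
    have "{x \<in> ?A. x + h \<notin> ?A} \<subseteq> (T \<inter> ball 0 R) \<union> ?W"
    proof
      fix x assume x: "x \<in> {x \<in> ?A. x + h \<notin> ?A}"
      then have xD: "x \<in> D" and xR: "norm x < R" by auto
      show "x \<in> (T \<inter> ball 0 R) \<union> ?W"
      proof (cases "x \<in> T")
        case False
        have "ball x r \<inter> D \<noteq> {}" using r xD by (metis IntI centre_in_ball empty_iff)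
        then have "ball x r \<subseteq> D"
          using False unfolding T_def by (rule ball_subset_of_far_from_frontier[rotated])
        moreover have "x + h \<in> ball x r" using h by (simp add: dist_norm)
        ultimately have "x + h \<in> D" by blast
        moreover have "norm (x + h) < R + 2 * r"
          using norm_triangle_ineq[of x h] h xR r by linarith
        ultimately have "x + h \<in> ?G" using x by auto
        then have "x \<in> ?W" by (rule image_eqI[rotated]) simp
        then show ?thesis by simp
      qed (use xR in auto)
    qed
    then have "?\<mu> {x \<in> ?A. x + h \<notin> ?A} \<le> ?\<mu> ((T \<inter> ball 0 R) \<union> ?W)"
      using TR W lmeasurable_translate_escape[OF A(1)]
      by (intro measure_mono_fmeasurable fmeasurable.Un fmeasurableD)
    also have "\<dots> \<le> ?\<mu> (T \<inter> ball 0 R) + ?\<mu> ?W"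
      using TR W by (intro measure_Un_le fmeasurableD)
    also have "?\<mu> ?W = ?\<mu> ?G" by (rule measure_translation)
    finally show "?\<mu> {x \<in> ?A. x + h \<notin> ?A} \<le> 2 * ?\<mu> ?G" using TG by linarith
  qed
  then show ?thesis using A(2) G(2) by simp
qed

text \<open>If the boundary stays at distance \<open>r\<close> from \<open>B\<^bsub>R\<^esub>\<close>, any point of \<open>D \<inter> B\<^bsub>R\<^esub>\<close> will do. Otherwise
  the left side of the comparison inequality is the volume of a nonempty open set, so the set on its right side,
  whose points lie in \<open>D\<close> at distance at least \<open>r\<close> from the boundary, is not empty.\<close>

lemma Per_minimizer_contains_ball:
  fixes \<Omega> E :: "'a::euclidean_space set"
  assumes \<Omega>: "bounded_domain \<Omega>" and min: "Per_minimizer r \<Omega> E" and r: "0 < r"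
    and sub: "ball 0 (R + 2 * r) \<subseteq> \<Omega>" and pos: "0 < measure lebesgue (E \<inter> ball 0 R)"
  obtains x where "x \<in> ball 0 (R + 2 * r)" "ball x r \<subseteq> density_one E"
proof -
  let ?\<mu> = "measure (lebesgue :: 'a measure)"
  define D where "D = density_one E"
  define T where "T = ball_dilation (frontier D) r"
  have E: "E \<in> sets lebesgue" using min by (simp add: Per_minimizer_def)
  have T: "open T" unfolding T_def by (rule open_ball_dilation)
  have "\<exists>x. x \<in> D \<inter> ball 0 (R + 2 * r) - T"
  proof (cases "T \<inter> ball 0 R = {}")
    case True
    have "?\<mu> (D \<inter> ball 0 R) \<noteq> 0"
      using measure_density_one_Int(2)[OF E lmeasurable_ball, of 0 R] pos by (simp add: D_def)
    then have "D \<inter> ball 0 R \<noteq> {}" by auto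
    then show ?thesis using True r by fastforce
  next
    case False
    have "open (T \<inter> ball 0 R)" using T by auto
    then have "\<not> negligible (T \<inter> ball 0 R)" using False by (rule open_not_negligible)
    moreover have "T \<inter> ball 0 R \<in> lmeasurable" using T by (intro lmeasurable_open) auto
    ultimately have "?\<mu> (T \<inter> ball 0 R) \<noteq> 0" by (simp add: negligible_iff_measure)
    moreover have "?\<mu> (T \<inter> ball 0 R) \<le> ?\<mu> (D \<inter> (ball 0 (R + 2 * r) - ball 0 R) - T)"
      using Per_minimizer_dilation_in_ball_le[OF \<Omega> min r sub] by (simp add: T_def D_def)
    ultimately have "D \<inter> (ball 0 (R + 2 * r) - ball 0 R) - T \<noteq> {}"
      by (metis measure_empty measure_le_0_iff)
    then show ?thesis by auto
  qed
  then obtain x where x: "x \<in> D" "x \<in> ball 0 (R + 2 * r)" "x \<notin> T" by auto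
  have "ball x r \<inter> D \<noteq> {}" using r x(1) by (metis IntI centre_in_ball empty_iff)
  then have "ball x r \<subseteq> D"
    using x(3) unfolding T_def by (rule ball_subset_of_far_from_frontier[rotated])
  then show ?thesis using x(2) that by (simp add: D_def)
qed

text \<open>The ball of radius \<open>r\<close> in \<open>D\<close> may stick out of \<open>B\<^bsub>R + 2r\<^esub>\<close>, but moving its centre towards the origin fits a ball
  of half the radius into both.\<close>

lemma Per_minimizer_mass_lower_bound:
  fixes \<Omega> E :: "'a::euclidean_space set"
  assumes \<Omega>: "bounded_domain \<Omega>" and min: "Per_minimizer r \<Omega> E" and r: "0 < r" and R: "0 < R"
    and sub: "ball 0 (R + 2 * r) \<subseteq> \<Omega>" and pos: "0 < measure lebesgue (E \<inter> ball 0 R)"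
  shows "measure lebesgue (ball (0::'a) (r / 2)) \<le> measure lebesgue (E \<inter> ball 0 (R + 2 * r))"
proof -
  let ?\<rho> = "R + 2 * r"
  have E: "E \<in> sets lebesgue" using min by (simp add: Per_minimizer_def)
  obtain x where x: "x \<in> ball 0 ?\<rho>" "ball x r \<subseteq> density_one E"
    using Per_minimizer_contains_ball[OF \<Omega> min r sub pos] .
  \<comment> \<open>shrinking by \<open>t\<close> maps the ball of radius \<open>R + 2 * r\<close> onto the one of radius \<open>R + 2 * r - r / 2\<close>\<close>
  define t where "t = r / (2 * ?\<rho>)"
  define z where "z = (1 - t) *\<^sub>R x"
  have t: "0 \<le> t" "t \<le> 1" "t * ?\<rho> = r / 2" using r R by (auto simp: t_def field_simps)
  have nx: "norm x \<le> ?\<rho>" using x(1) by simp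
  have "dist x z = t * norm x"
    using t by (simp add: z_def dist_norm scaleR_diff_left)
  also have "\<dots> \<le> r / 2" using mult_left_mono[OF nx t(1)] t(3) by simp
  finally have "ball z (r / 2) \<subseteq> ball x r"
    by (simp add: ball_subset_ball_iff dist_commute)
  moreover have "norm z = (1 - t) * norm x" using t by (simp add: z_def)
  then have "norm z \<le> ?\<rho> - r / 2"
    using mult_left_mono[OF nx, of "1 - t"] t by (simp add: algebra_simps)
  then have "ball z (r / 2) \<subseteq> ball 0 ?\<rho>" by (simp add: ball_subset_ball_iff)
  ultimately have "ball z (r / 2) \<subseteq> density_one E \<inter> ball 0 ?\<rho>" using x(2) by blast
  then have "measure lebesgue (ball z (r / 2)) \<le> measure lebesgue (density_one E \<inter> ball 0 ?\<rho>)"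
    using measure_density_one_Int(1)[OF E lmeasurable_ball] by (intro measure_mono_fmeasurable) auto
  also have "\<dots> = measure lebesgue (E \<inter> ball 0 ?\<rho>)"
    by (rule measure_density_one_Int(2)[OF E lmeasurable_ball])
  also have "measure lebesgue (ball z (r / 2)) = measure lebesgue (ball (0::'a) (r / 2))"
    using r by (simp add: content_ball)
  finally show ?thesis .
qed

section \<open>Growth of the mass in concentric balls\<close>

text \<open>By convexity the power lies below its chord on the unit interval.\<close>

lemma one_plus_power_le:
  fixes x :: real
  assumes "0 \<le> x" "x \<le> 1"
  shows "(1 + x) ^ n \<le> 1 + (2 ^ n - 1) * x"
proof (induction n)
  case (Suc n)
  have "(1 + x) ^ Suc n \<le> (1 + (2 ^ n - 1) * x) * (1 + x)"
    using mult_right_mono[OF Suc.IH, of "1 + x"] assms(1) by (simp add: mult.commute)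
  also have "\<dots> = 1 + 2 ^ n * x + (2 ^ n - 1) * (x * x)" by (simp add: algebra_simps)
  also have "\<dots> \<le> 1 + 2 ^ n * x + (2 ^ n - 1) * x"
    using assms by (intro add_left_mono mult_left_mono mult_left_le) auto
  also have "\<dots> = 1 + (2 ^ Suc n - 1) * x" by (simp add: algebra_simps)
  finally show ?case .
qed simp

text \<open>Here \<open>p\<close> and \<open>p'\<close> are the \<open>n\<close>-th roots of two successive masses, and \<open>(q * \<rho>) ^ n\<close> is the volume of a ball of radius
  \<open>\<rho>\<close>. For \<open>p < q * r / 4\<close> the lower bound on \<open>p'\<close> suffices. For larger \<open>p\<close> the hypothesis is used with \<open>N\<close> just above
  \<open>2 * p / (q * r)\<close>; the relative gain in mass is then of order \<open>q * r / p\<close>, and so is the relative gain in \<open>p\<close>,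
  with a factor \<open>2 ^ n\<close> lost to Bernoulli's inequality in reverse.\<close>

lemma radius_growth_of_mass_growth:
  fixes p p' q r :: real
  assumes n: "0 < n" and pos: "0 < p" "0 \<le> p'" "0 < q" "0 < r"
    and lower: "q * (r / 2) \<le> p'"
    and iso: "\<And>N. 0 < N \<Longrightarrow> 2 * p ^ n < (q * (real N * r)) ^ n \<Longrightarrow> p ^ n \<le> 4 * real N * (p' ^ n - p ^ n)"
  shows "p + 2 * (q / (48 * 2 ^ n)) * r \<le> p'"
proof (cases "p < q * r / 4")
  case True
  have "(1::real) \<le> 2 ^ n" by simp
  then have "q * r / (24 * 2 ^ n) \<le> q * r / 24"
    using pos by (intro divide_left_mono) auto
  moreover have "2 * (q / (48 * 2 ^ n)) * r = q * r / (24 * 2 ^ n)" by simp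
  ultimately have "2 * (q / (48 * 2 ^ n)) * r \<le> q * r / 24" by simp
  moreover have "0 < q * r" "q * (r / 2) = q * r / 2" using pos by simp_all
  ultimately show ?thesis using True lower by linarith
next
  case False
  \<comment> \<open>the least number that makes the ball of radius \<open>N * r\<close> exceed \<open>(2 * p) ^ n\<close>, hence \<open>2 * p ^ n\<close>, in volume\<close>
  define N where "N = nat \<lfloor>2 * p / (q * r)\<rfloor> + 1"
  have qr: "0 < q * r" using pos by simp
  have ge0: "0 \<le> 2 * p / (q * r)" using pos by simp
  have "2 * p / (q * r) < real N"
    unfolding N_def using ge0 by linarith
  then have "2 * p < q * (real N * r)" using qr by (simp add: field_simps)
  then have "(2 * p) ^ n < (q * (real N * r)) ^ n"
    using pos(1) n by (intro power_strict_mono) auto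
  moreover have "(2::real) ^ 1 \<le> 2 ^ n" using n by (intro power_increasing) auto
  then have "2 * p ^ n \<le> (2 * p) ^ n" using pos(1) by (simp add: power_mult_distrib)
  moreover have "0 < N" by (simp add: N_def)
  ultimately have growth: "p ^ n \<le> 4 * real N * (p' ^ n - p ^ n)" using iso[of N] by linarith
  have "real N \<le> 2 * p / (q * r) + 1"
    unfolding N_def using ge0 by linarith
  also have "1 \<le> 4 * p / (q * r)" using False qr by (simp add: field_simps)
  finally have N_le: "4 * real N \<le> 24 * p / (q * r)" by simp
  have "0 < p' ^ n - p ^ n"
    using growth zero_less_power[OF pos(1), of n] \<open>0 < N\<close>
    by (smt (verit) mult_nonneg_nonpos of_nat_0_le_iff)
  then have "p ^ n \<le> 24 * p / (q * r) * (p' ^ n - p ^ n)"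
    using growth mult_right_mono[OF N_le, of "p' ^ n - p ^ n"] by linarith
  then have "p ^ n * (q * r / (24 * p)) \<le> p' ^ n - p ^ n"
    using pos qr by (simp add: field_simps)
  then have mass: "p ^ n * (1 + q * r / (24 * p)) \<le> p' ^ n" by (simp add: algebra_simps)
  \<comment> \<open>the largest relative increase for which the upper bound \<open>1 + 2 ^ n * x\<close> of \<open>(1 + x) ^ n\<close> fits the gain in mass\<close>
  define x where "x = q * r / (24 * p) / 2 ^ n"
  have le1: "q * r / (24 * p) \<le> 1" using False pos by (simp add: field_simps)
  have x0: "0 \<le> x" and x_eq: "2 ^ n * x = q * r / (24 * p)"
    using pos by (simp_all add: x_def)
  have "x \<le> 2 ^ n * x" using mult_right_mono[of 1 "2 ^ n" x] x0 by simp
  then have x1: "x \<le> 1" using le1 x_eq by linarith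
  have "(1 + x) ^ n \<le> 1 + q * r / (24 * p)"
    using one_plus_power_le[OF x0 x1, of n] x0 x_eq by (simp add: algebra_simps)
  then have "p ^ n * (1 + x) ^ n \<le> p ^ n * (1 + q * r / (24 * p))"
    using pos(1) by (intro mult_left_mono) auto
  then have "(p * (1 + x)) ^ n \<le> p' ^ n"
    using mass unfolding power_mult_distrib by linarith
  then have "p * (1 + x) \<le> p'" using pos(2) n by (simp add: power_mono_iff x0 pos(1) less_imp_le)
  moreover have "p * x = 2 * (q / (48 * 2 ^ n)) * r" using pos by (simp add: x_def)
  ultimately show ?thesis by (simp add: algebra_simps)
qed

lemma powr_inverse_power:
  fixes x :: real
  assumes "0 \<le> x" "0 < n"
  shows "(x powr (1 / real n)) ^ n = x"
  using assms by (cases "x = 0") (simp_all add: powr_realpow[symmetric] powr_powr zero_power)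

lemma measure_annulus:
  fixes E :: "'a::euclidean_space set"
  assumes "E \<in> sets lebesgue" "0 \<le> s"
  shows "measure lebesgue (E \<inter> ball 0 (R + s))
       = measure lebesgue (E \<inter> ball 0 R) + measure lebesgue (E \<inter> (ball 0 (R + s) - ball 0 R))"
proof -
  have "E \<inter> ball 0 (R + s) \<in> lmeasurable"
    using fmeasurable_Int_fmeasurable[OF lmeasurable_ball assms(1)] by (simp add: Int_commute)
  moreover have "ball (0::'a) R \<subseteq> ball 0 (R + s)" using assms(2) by (intro subset_ball) simp
  then have "E \<inter> ball 0 (R + s) \<inter> ball 0 R = E \<inter> ball 0 R" by auto
  ultimately show ?thesis
    using measure_Int_Diff[of "E \<inter> ball 0 (R + s)" lebesgue "ball 0 R"] by (simp add: Int_Diff)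
qed

lemma radius_growth_step:
  fixes \<Omega> E :: "'a::euclidean_space set"
  defines "q \<equiv> measure lebesgue (ball (0::'a) 1) powr (1 / DIM('a))"
  assumes \<Omega>: "bounded_domain \<Omega>" and min: "Per_minimizer r \<Omega> E" and r: "0 < r" and R: "0 < R"
    and sub: "ball 0 (R + 2 * r) \<subseteq> \<Omega>" and pos: "0 < measure lebesgue (E \<inter> ball 0 R)"
  shows "measure lebesgue (E \<inter> ball 0 R) powr (1 / DIM('a)) + 2 * (q / (48 * 2 ^ DIM('a))) * r
       \<le> measure lebesgue (E \<inter> ball 0 (R + 2 * r)) powr (1 / DIM('a))"
proof -
  let ?n = "DIM('a)" and ?\<mu> = "measure (lebesgue :: 'a measure)"
  let ?m = "\<lambda>\<rho>. ?\<mu> (E \<inter> ball 0 \<rho>)"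
  have E: "E \<in> sets lebesgue" using min by (simp add: Per_minimizer_def)
  have v: "0 < ?\<mu> (ball 0 1)" by (simp add: content_ball_pos)
  have root: "(?m \<rho> powr (1 / ?n)) ^ ?n = ?m \<rho>" for \<rho> by (intro powr_inverse_power) auto
  have ball: "?\<mu> (ball 0 \<rho>) = (q * \<rho>) ^ ?n" if "0 \<le> \<rho>" for \<rho>
    using content_ball_conv_unit_ball[OF that, of "0::'a"] powr_inverse_power[of "?\<mu> (ball 0 1)" ?n]
    by (simp add: q_def power_mult_distrib)
  have q: "0 < q" using v by (simp add: q_def)
  show ?thesis
  proof (rule radius_growth_of_mass_growth)
    have "(q * (r / 2)) ^ ?n \<le> (?m (R + 2 * r) powr (1 / ?n)) ^ ?n"
      using Per_minimizer_mass_lower_bound[OF \<Omega> min r R sub pos] ball[of "r / 2"] r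
      unfolding root by simp
    then show "q * (r / 2) \<le> ?m (R + 2 * r) powr (1 / ?n)"
      using q r by (subst (asm) power_mono_iff) auto
  next
    fix N :: nat assume N: "0 < N" and less: "2 * (?m R powr (1 / ?n)) ^ ?n < (q * (real N * r)) ^ ?n"
    have "2 * ?m R < ?\<mu> (ball 0 (real N * r))"
      using less r unfolding root by (subst ball) auto
    then show "(?m R powr (1 / ?n)) ^ ?n
        \<le> 4 * real N * ((?m (R + 2 * r) powr (1 / ?n)) ^ ?n - (?m R powr (1 / ?n)) ^ ?n)"
      using Per_minimizer_mass_le_annulus_mass[OF \<Omega> min r sub N] measure_annulus[OF E, of "2 * r" R] r
      unfolding root by simp
  qed (use pos q r in auto)
qed

lemma radius_growth:
  fixes \<Omega> E :: "'a::euclidean_space set"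
  defines "c \<equiv> measure lebesgue (ball (0::'a) 1) powr (1 / DIM('a)) / (48 * 2 ^ DIM('a))"
  assumes \<Omega>: "bounded_domain \<Omega>" and min: "Per_minimizer r \<Omega> E" and r: "0 < r" and R: "0 < R"
    and pos: "0 < measure lebesgue (E \<inter> ball 0 R)"
    and sub: "ball 0 (R + 2 * real k * r) \<subseteq> \<Omega>"
  shows "measure lebesgue (E \<inter> ball 0 R) powr (1 / DIM('a)) + 2 * c * real k * r
       \<le> measure lebesgue (E \<inter> ball 0 (R + 2 * real k * r)) powr (1 / DIM('a))"
  using sub
proof (induction k)
  case (Suc k)
  let ?m = "\<lambda>\<rho>. measure lebesgue (E \<inter> ball 0 \<rho>) powr (1 / DIM('a))"
  let ?\<rho> = "R + 2 * real k * r"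
  have next_radius: "R + 2 * real (Suc k) * r = ?\<rho> + 2 * r" by (simp add: algebra_simps)
  have c: "0 < c" by (simp add: c_def content_ball_pos)
  have "ball (0::'a) ?\<rho> \<subseteq> ball 0 (?\<rho> + 2 * r)" using r by (intro subset_ball) simp
  then have IH: "?m R + 2 * c * real k * r \<le> ?m ?\<rho>"
    using Suc unfolding next_radius by blast
  have "0 < ?m R" using pos by simp
  then have "0 < ?m ?\<rho>" using IH c r by (smt (verit) mult_nonneg_nonneg of_nat_0_le_iff)
  then have "0 < measure lebesgue (E \<inter> ball 0 ?\<rho>)" by (simp add: zero_less_measure_iff)
  moreover have "0 < ?\<rho>" using R r by (simp add: add_pos_nonneg)
  ultimately have "?m ?\<rho> + 2 * c * r \<le> ?m (?\<rho> + 2 * r)"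
    using radius_growth_step[OF \<Omega> min r] Suc.prems unfolding next_radius c_def by blast
  then show ?case using IH unfolding next_radius by (simp add: algebra_simps)
qed simp

theorem mass_growth_uniform:
  "\<exists>c>0. \<forall>r>0. \<forall>(\<Omega> :: 'a::euclidean_space set) E R k.
     bounded_domain \<Omega> \<longrightarrow> Per_minimizer r \<Omega> E \<longrightarrow> 0 < R \<longrightarrow>
     0 < measure lebesgue (E \<inter> ball 0 R) \<longrightarrow> ball 0 (R + 2 * real k * r) \<subseteq> \<Omega> \<longrightarrow>
     (measure lebesgue (E \<inter> ball 0 R) powr (1 / DIM('a)) + 2 * c * real k * r) ^ DIM('a)
       \<le> measure lebesgue (E \<inter> ball 0 (R + 2 * real k * r))"
proof (intro exI conjI allI impI)
  let ?c = "measure lebesgue (ball (0::'a) 1) powr (1 / DIM('a)) / (48 * 2 ^ DIM('a))"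
  show c: "0 < ?c" by (simp add: content_ball_pos)
  fix r :: real and \<Omega> E :: "'a set" and R :: real and k :: nat
  assume r: "0 < r" and \<Omega>: "bounded_domain \<Omega>" and min: "Per_minimizer r \<Omega> E" and R: "0 < R"
    and pos: "0 < measure lebesgue (E \<inter> ball 0 R)" and sub: "ball 0 (R + 2 * real k * r) \<subseteq> \<Omega>"
  let ?m = "\<lambda>\<rho>. measure lebesgue (E \<inter> ball 0 \<rho>)"
  have "0 \<le> ?m R powr (1 / DIM('a)) + 2 * ?c * real k * r" using c r by simp
  then have "(?m R powr (1 / DIM('a)) + 2 * ?c * real k * r) ^ DIM('a)
      \<le> (?m (R + 2 * real k * r) powr (1 / DIM('a))) ^ DIM('a)"
    using radius_growth[OF \<Omega> min r R pos sub] by (intro power_mono)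
  also have "\<dots> = ?m (R + 2 * real k * r)" by (intro powr_inverse_power) auto
  finally show "(?m R powr (1 / DIM('a)) + 2 * ?c * real k * r) ^ DIM('a) \<le> ?m (R + 2 * real k * r)" .
qed

text \<open>A single \<open>N\<close> is allowed at all radii, so each step multiplies the mass by the same factor.\<close>

lemma mass_growth_geometric:
  fixes \<Omega> E :: "'a::euclidean_space set"
  assumes \<Omega>: "bounded_domain \<Omega>" and min: "Per_minimizer r \<Omega> E" and r: "0 < r"
    and sub: "ball 0 (R + 2 * real k * r) \<subseteq> \<Omega>" and N: "0 < N"
    and bound: "\<And>j. j < k \<Longrightarrow>
        2 * measure lebesgue (E \<inter> ball 0 (R + 2 * real j * r)) < measure lebesgue (ball (0::'a) (real N * r))"
  shows "measure lebesgue (E \<inter> ball 0 R) * (1 + 1 / (4 * real N)) ^ k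
       \<le> measure lebesgue (E \<inter> ball 0 (R + 2 * real k * r))"
  using sub bound
proof (induction k)
  case (Suc k)
  let ?m = "\<lambda>\<rho>. measure lebesgue (E \<inter> ball 0 \<rho>)"
  let ?\<rho> = "R + 2 * real k * r"
  have E: "E \<in> sets lebesgue" using min by (simp add: Per_minimizer_def)
  have next_radius: "R + 2 * real (Suc k) * r = ?\<rho> + 2 * r" by (simp add: algebra_simps)
  have "ball (0::'a) ?\<rho> \<subseteq> ball 0 (?\<rho> + 2 * r)" using r by (intro subset_ball) simp
  then have IH: "?m R * (1 + 1 / (4 * real N)) ^ k \<le> ?m ?\<rho>"
    using Suc unfolding next_radius by fastforce
  have "?m ?\<rho> \<le> 4 * real N * measure lebesgue (E \<inter> (ball 0 (?\<rho> + 2 * r) - ball 0 ?\<rho>))"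
    using Suc.prems(1) Suc.prems(2)[of k] unfolding next_radius
    by (intro Per_minimizer_mass_le_annulus_mass[OF \<Omega> min r _ N]) auto
  then have "?m ?\<rho> * (1 + 1 / (4 * real N)) \<le> ?m (?\<rho> + 2 * r)"
    using measure_annulus[OF E, of "2 * r" ?\<rho>] r N by (simp add: field_simps)
  moreover have "?m R * (1 + 1 / (4 * real N)) ^ k * (1 + 1 / (4 * real N)) \<le> ?m ?\<rho> * (1 + 1 / (4 * real N))"
    using IH by (intro mult_right_mono) auto
  ultimately show ?case unfolding next_radius by (simp add: mult_ac)
qed simp

theorem theorem1p18:
  shows
   "(\<forall>(r::real) > 0. \<forall>(\<omega>::real) > 0. \<exists>c > 0.
          \<forall>(\<Omega> :: (real ^ 'n) set) E (R::real) (k::nat).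
             bounded_domain \<Omega> \<longrightarrow> Per_minimizer r \<Omega> E \<longrightarrow>
             R > 0 \<longrightarrow> ball 0 R \<subseteq> \<Omega> \<longrightarrow>
             measure lebesgue (E \<inter> ball 0 R) = \<omega> \<longrightarrow>
             ball 0 (R + 2 * real k * r) \<subseteq> \<Omega> \<longrightarrow>
             measure lebesgue (E \<inter> ball 0 (R + 2 * real k * r))
               \<ge> (\<omega> powr (1 / real CARD('n)) + 2 * c * real k * r) ^ CARD('n))
    \<and>
    (CARD('n) = 1 \<longrightarrow>
       (\<exists>c > 0. \<forall>(r::real) > 0. \<forall>(\<omega>::real) > 0.
          \<forall>(\<Omega> :: (real ^ 'n) set) E (R::real) (k::nat).
             bounded_domain \<Omega> \<longrightarrow> Per_minimizer r \<Omega> E \<longrightarrow>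
             R > 0 \<longrightarrow> ball 0 R \<subseteq> \<Omega> \<longrightarrow>
             measure lebesgue (E \<inter> ball 0 R) = \<omega> \<longrightarrow>
             ball 0 (R + 2 * real k * r) \<subseteq> \<Omega> \<longrightarrow>
             measure lebesgue (E \<inter> ball 0 (R + 2 * real k * r))
               \<ge> (\<omega> powr (1 / real CARD('n)) + 2 * c * real k * r) ^ CARD('n)))
    \<and>
    (\<forall>(cu::real) > 0. \<exists>c > 0. \<forall>(r::real) > 0. \<forall>(\<omega>::real) > 0. \<omega> \<ge> cu * r ^ CARD('n) \<longrightarrow>
          (\<forall>(\<Omega> :: (real ^ 'n) set) E (R::real) (k::nat).
             bounded_domain \<Omega> \<longrightarrow> Per_minimizer r \<Omega> E \<longrightarrow>
             R > 0 \<longrightarrow> ball 0 R \<subseteq> \<Omega> \<longrightarrow>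
             measure lebesgue (E \<inter> ball 0 R) = \<omega> \<longrightarrow>
             ball 0 (R + 2 * real k * r) \<subseteq> \<Omega> \<longrightarrow>
             measure lebesgue (E \<inter> ball 0 (R + 2 * real k * r))
               \<ge> (\<omega> powr (1 / real CARD('n)) + 2 * c * real k * r) ^ CARD('n)))
    \<and>
    (\<forall>(C::real) > 0. \<exists>c > 0. \<forall>(r::real) > 0. \<forall>(\<omega>::real) > 0.
          \<forall>(\<Omega> :: (real ^ 'n) set) E (R::real) (k::nat).
             bounded_domain \<Omega> \<longrightarrow> Per_minimizer r \<Omega> E \<longrightarrow>
             R > 0 \<longrightarrow> ball 0 R \<subseteq> \<Omega> \<longrightarrow>
             measure lebesgue (E \<inter> ball 0 R) = \<omega> \<longrightarrow>
             ball 0 (R + 2 * real k * r) \<subseteq> \<Omega> \<longrightarrow>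
             k \<ge> 1 \<longrightarrow>
             measure lebesgue (E \<inter> ball 0 (R + 2 * (real k - 1) * r)) \<le> C * r ^ CARD('n) \<longrightarrow>
             measure lebesgue (E \<inter> ball 0 (R + 2 * real k * r)) \<ge> \<omega> * (1 + c) ^ k)"
proof -
  obtain c :: real where c: "0 < c"
    and growth: "\<And>r (\<Omega> :: (real ^ 'n) set) E R k. 0 < r \<Longrightarrow> bounded_domain \<Omega> \<Longrightarrow> Per_minimizer r \<Omega> E \<Longrightarrow>
      0 < R \<Longrightarrow> 0 < measure lebesgue (E \<inter> ball 0 R) \<Longrightarrow> ball 0 (R + 2 * real k * r) \<subseteq> \<Omega> \<Longrightarrow>
      (measure lebesgue (E \<inter> ball 0 R) powr (1 / real CARD('n)) + 2 * c * real k * r) ^ CARD('n)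
        \<le> measure lebesgue (E \<inter> ball 0 (R + 2 * real k * r))"
    using mass_growth_uniform[where 'a = "real ^ 'n"] by auto
  have geometric: "\<exists>c > 0. \<forall>(r::real) > 0. \<forall>(\<omega>::real) > 0.
      \<forall>(\<Omega> :: (real ^ 'n) set) E (R::real) (k::nat).
         bounded_domain \<Omega> \<longrightarrow> Per_minimizer r \<Omega> E \<longrightarrow>
         R > 0 \<longrightarrow> ball 0 R \<subseteq> \<Omega> \<longrightarrow>
         measure lebesgue (E \<inter> ball 0 R) = \<omega> \<longrightarrow>
         ball 0 (R + 2 * real k * r) \<subseteq> \<Omega> \<longrightarrow>
         k \<ge> 1 \<longrightarrow>
         measure lebesgue (E \<inter> ball 0 (R + 2 * (real k - 1) * r)) \<le> C * r ^ CARD('n) \<longrightarrow>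
         measure lebesgue (E \<inter> ball 0 (R + 2 * real k * r)) \<ge> \<omega> * (1 + c) ^ k"
    if C: "0 < C" for C :: real
  proof -
    let ?n = "CARD('n)"
    let ?v = "measure lebesgue (ball (0 :: real ^ 'n) 1)"
    have v: "0 < ?v" by (simp add: content_ball_pos)
    \<comment> \<open>a number \<open>N\<close> that is good for every mass up to \<open>C * r ^ ?n\<close>, whatever \<open>r\<close> is\<close>
    obtain N0 :: nat where "2 * C / ?v < real N0" using reals_Archimedean2 by blast
    then obtain N :: nat where N: "0 < N" "2 * C / ?v < real N"
      using C v by (metis divide_pos_pos gr0I less_trans mult_pos_pos of_nat_0 order_less_irrefl zero_less_numeral)
    have "2 * C / ?v < real N ^ 1" using N(2) by simp
    also have "\<dots> \<le> real N ^ ?n" using N(1) by (intro power_increasing) (auto simp: Suc_leI)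
    finally have "2 * C / ?v < real N ^ ?n" .
    then have NC: "2 * C < ?v * real N ^ ?n" using v by (simp add: pos_divide_less_eq mult.commute)
    show ?thesis
    proof (intro exI[of _ "1 / (4 * real N)"] conjI allI impI)
      fix r \<omega> :: real and \<Omega> E :: "(real ^ 'n) set" and R :: real and k :: nat
      assume r: "0 < r" and \<Omega>: "bounded_domain \<Omega>" and min: "Per_minimizer r \<Omega> E"
        and \<omega>: "measure lebesgue (E \<inter> ball 0 R) = \<omega>" and sub: "ball 0 (R + 2 * real k * r) \<subseteq> \<Omega>"
        and bound: "measure lebesgue (E \<inter> ball 0 (R + 2 * (real k - 1) * r)) \<le> C * r ^ ?n"
      have E: "E \<in> sets lebesgue" using min by (simp add: Per_minimizer_def)
      have "2 * measure lebesgue (E \<inter> ball 0 (R + 2 * real j * r))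
          < measure lebesgue (ball (0 :: real ^ 'n) (real N * r))" if "j < k" for j
      proof -
        have meas: "E \<inter> ball 0 \<rho> \<in> lmeasurable" for \<rho>
          using fmeasurable_Int_fmeasurable[OF lmeasurable_ball E] by (simp add: Int_commute)
        have "2 * real j * r \<le> 2 * (real k - 1) * r" using that r by (intro mult_right_mono) auto
        then have "ball (0 :: real ^ 'n) (R + 2 * real j * r) \<subseteq> ball 0 (R + 2 * (real k - 1) * r)"
          by (intro subset_ball add_left_mono)
        then have "measure lebesgue (E \<inter> ball 0 (R + 2 * real j * r))
            \<le> measure lebesgue (E \<inter> ball 0 (R + 2 * (real k - 1) * r))"
          using meas by (intro measure_mono_fmeasurable fmeasurableD) auto
        then have "2 * measure lebesgue (E \<inter> ball 0 (R + 2 * real j * r)) \<le> 2 * C * r ^ ?n"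
          using bound by simp
        also have "\<dots> < ?v * real N ^ ?n * r ^ ?n"
          using NC r by (intro mult_strict_right_mono) auto
        also have "\<dots> = measure lebesgue (ball (0 :: real ^ 'n) (real N * r))"
          using content_ball_conv_unit_ball[of "real N * r" "0 :: real ^ 'n"] r
          by (simp add: power_mult_distrib mult_ac)
        finally show ?thesis .
      qed
      then show "\<omega> * (1 + 1 / (4 * real N)) ^ k \<le> measure lebesgue (E \<inter> ball 0 (R + 2 * real k * r))"
        using mass_growth_geometric[OF \<Omega> min r sub N(1)] \<omega> by blast
    qed (use N(1) in simp)
  qed
  show ?thesis
  proof (intro conjI, goal_cases)
    case 1
    show ?case using c growth by (intro allI impI exI[of _ c] conjI) auto
  next
    case 2
    show ?case using c growth by (intro impI exI[of _ c] conjI allI) auto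
  next
    case 3
    show ?case using c growth by (intro allI impI exI[of _ c] conjI) auto
  next
    case 4
    show ?case using geometric by (intro allI impI)
  qed
qed

end
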